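(* For a ring $R$, consider the following statements: (1) $R$ is $P$-symmetric. (2) The polynomial ring $R[x]$ is $P$-symmetric. (3) The ring of Laurent polynomials $R[x;x^{-1}]$ is $P$-symmetric. Then for any ring $R$, $(2)\Rightarrow(3)\Rightarrow(1)$. Further, $(1)\Rightarrow(2)$ holds if $R$ is an Armendariz ring.
   Context: Rings are associative with identity (not necessarily commutative); the indeterminate $x$ commutes with the elements of $R$. $P(R)$ denotes the prime radical of a ring $R$ (the intersection of all prime two-sided ideals of $R$). A ring $R$ is $P$-symmetric if for any $a,b,c\in R$, $abc=0$ implies $bac\in P(R)$. A ring $R$ is Armendariz if for any $f(x)=\sum_{i=0}^{m}a_ix^i$ and $g(x)=\sum_{j=0}^{n}b_jx^j$ in $R[x]$, $f(x)g(x)=0$ implies $a_ib_j=0$ for every $i,j$. *)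

theory Defs
  imports "HOL-Algebra.UnivPoly" "HOL-Algebra.Ideal_Product"
begin

text \<open>
  The library's \<open>primeideal\<close> is confined to commutative rings (and tests elements, i.e. complete
  primeness). For a noncommutative ring primeness is tested on products of two-sided ideals.
\<close>

definition prime_two_sided_ideal :: "'a set \<Rightarrow> ('a, 'm) ring_scheme \<Rightarrow> bool" where
  "prime_two_sided_ideal P R \<longleftrightarrow>
     ideal P R \<and> P \<noteq> carrier R \<and>
     (\<forall>I J. ideal I R \<longrightarrow> ideal J R \<longrightarrow> ideal_prod R I J \<subseteq> P \<longrightarrow> I \<subseteq> P \<or> J \<subseteq> P)"

text \<open>
  Intersecting with the carrier makes the empty intersection (zero ring) the whole ring.
\<close>

definition prime_radical :: "('a, 'm) ring_scheme \<Rightarrow> 'a set" where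
  "prime_radical R = carrier R \<inter> \<Inter>{P. prime_two_sided_ideal P R}"

definition P_symmetric :: "('a, 'm) ring_scheme \<Rightarrow> bool" where
  "P_symmetric R \<longleftrightarrow>
     (\<forall>a \<in> carrier R. \<forall>b \<in> carrier R. \<forall>c \<in> carrier R.
        a \<otimes>\<^bsub>R\<^esub> b \<otimes>\<^bsub>R\<^esub> c = \<zero>\<^bsub>R\<^esub> \<longrightarrow> b \<otimes>\<^bsub>R\<^esub> a \<otimes>\<^bsub>R\<^esub> c \<in> prime_radical R)"

definition Armendariz :: "('a, 'm) ring_scheme \<Rightarrow> bool" where
  "Armendariz R \<longleftrightarrow>
     (\<forall>f \<in> carrier (UP R). \<forall>g \<in> carrier (UP R).
        f \<otimes>\<^bsub>UP R\<^esub> g = \<zero>\<^bsub>UP R\<^esub> \<longrightarrow>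
        (\<forall>i j. coeff (UP R) f i \<otimes>\<^bsub>R\<^esub> coeff (UP R) g j = \<zero>\<^bsub>R\<^esub>))"

text \<open>
  The element \<open>p\<close> stands for the finite sum of the terms \<open>p n * x^n\<close> over all integers \<open>n\<close>, with
  \<open>x\<close> central. The product is convolution; it is summed over the support of \<open>p\<close> only, because
  \<open>finsum\<close> over an infinite index set is zero by convention.
\<close>

definition laurent_carrier :: "('a, 'm) ring_scheme \<Rightarrow> (int \<Rightarrow> 'a) set" where
  "laurent_carrier R = {p. p \<in> UNIV \<rightarrow> carrier R \<and> finite {n. p n \<noteq> \<zero>\<^bsub>R\<^esub>}}"

definition Laurent :: "('a, 'm) ring_scheme \<Rightarrow> (int \<Rightarrow> 'a) ring" where
  "Laurent R = \<lparr>
     carrier = laurent_carrier R,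
     mult = (\<lambda>p q n. \<Oplus>\<^bsub>R\<^esub>i \<in> {i. p i \<noteq> \<zero>\<^bsub>R\<^esub>}. p i \<otimes>\<^bsub>R\<^esub> q (n - i)),
     one = (\<lambda>n. if n = 0 then \<one>\<^bsub>R\<^esub> else \<zero>\<^bsub>R\<^esub>),
     zero = (\<lambda>n. \<zero>\<^bsub>R\<^esub>),
     add = (\<lambda>p q n. p n \<oplus>\<^bsub>R\<^esub> q n)\<rparr>"

end

theory Submission
  imports Defs "HOL-Algebra.QuotRing"
begin

text \<open>
  Each implication transports prime ideals in one direction only. Primes of \<open>R[x;x\<^sup>-\<^sup>1]\<close> contract to
  primes of \<open>R[x]\<close>, because every Laurent polynomial becomes a polynomial after multiplication by a
  central unit \<open>x\<^sup>k\<close>; primes of \<open>R[x]\<close> contract to primes of \<open>R\<close>, because \<open>x\<close> is central; and a prime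
  \<open>P\<close> of \<open>R\<close> extends to the prime \<open>P[x;x\<^sup>-\<^sup>1]\<close>, as leading coefficients outside \<open>P\<close> show. If \<open>R\<close> is
  Armendariz and \<open>f g h = 0\<close>, then all products \<open>a b c\<close> of coefficients of \<open>f\<close>, \<open>g\<close>, \<open>h\<close> vanish, so
  every \<open>b a c\<close> lies in \<open>P(R)\<close>.
\<close>

section \<open>Prime ideals and the prime radical\<close>

lemma (in ring) ideal_closedI:
  assumes "I \<subseteq> carrier R" "\<zero> \<in> I"
    and "\<And>a b. a \<in> I \<Longrightarrow> b \<in> I \<Longrightarrow> a \<oplus> b \<in> I"
    and "\<And>a x. a \<in> I \<Longrightarrow> x \<in> carrier R \<Longrightarrow> x \<otimes> a \<in> I"
    and "\<And>a x. a \<in> I \<Longrightarrow> x \<in> carrier R \<Longrightarrow> a \<otimes> x \<in> I"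
  shows "ideal I R"
proof (rule idealI[OF ring_axioms])
  show "subgroup I (add_monoid R)"
  proof (rule add.subgroupI)
    fix a assume a: "a \<in> I"
    then have "\<ominus> \<one> \<otimes> a \<in> I"
      by (rule assms(4)) simp
    moreover have "\<ominus> \<one> \<otimes> a = \<ominus> a"
      using a assms(1) by (auto simp: l_minus)
    ultimately show "\<ominus> a \<in> I"
      by simp
  qed (use assms in auto)
qed (use assms in auto)

lemma (in ideal) finsum_mem:
  assumes "\<And>i. i \<in> A \<Longrightarrow> f i \<in> I"
  shows "(\<Oplus>i\<in>A. f i) \<in> I"
  using assms
\<comment> \<open>For infinite \<open>A\<close> the sum is \<open>\<zero>\<close> by convention,
  which also lies in \<open>I\<close>; so the lemma applies to any index set.\<close>
proof (induct A rule: infinite_finite_induct)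
  case (insert i A)
  then have "(\<Oplus>j\<in>insert i A. f j) = f i \<oplus> (\<Oplus>j\<in>A. f j)"
    by (intro finsum_insert) (auto intro: Icarr)
  with insert show ?case
    by simp
qed auto

lemma (in ideal) add_mem_cancel:
  assumes "a \<oplus> b \<in> I" "b \<in> I" "a \<in> carrier R"
  shows "a \<in> I"
proof -
  have b: "b \<in> carrier R"
    using assms(2) by (rule Icarr)
  have "\<ominus> b \<in> I"
    using assms(2) by simp
  then have "(a \<oplus> b) \<oplus> \<ominus> b \<in> I"
    using assms(1) by simp
  then show ?thesis
    using assms(3) b by (simp add: a_assoc r_neg)
qed

lemma prime_two_sided_ideal_imp_ideal: "prime_two_sided_ideal P R \<Longrightarrow> ideal P R"
  by (simp add: prime_two_sided_ideal_def)

text \<open>Primeness speaks of products of ideals, so it has to be applied to the ideals generated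
  by \<open>a\<close> and \<open>b\<close>. Their product lies in \<open>P\<close> by two minimality
  arguments, which avoid writing elements of a generated ideal as sums: first \<open>b\<close> is
  enlarged to \<open>Idl {b}\<close>, then \<open>a\<close> to \<open>Idl {a}\<close>.\<close>

lemma prime_two_sided_idealD:
  fixes R (structure)
  assumes P: "prime_two_sided_ideal P R"
    and a: "a \<in> carrier R" and b: "b \<in> carrier R"
    and ab: "\<And>r. r \<in> carrier R \<Longrightarrow> a \<otimes> r \<otimes> b \<in> P"
  shows "a \<in> P \<or> b \<in> P"
proof -
  interpret ideal P R
    using P by (rule prime_two_sided_ideal_imp_ideal)
  \<comment> \<open>All \<open>y\<close> with \<open>a R y\<close> inside \<open>P\<close>.
    Multiplying \<open>y\<close> on the left by \<open>x\<close> only changes the middle factor from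
    \<open>r\<close> to \<open>r \<otimes> x\<close>; on the right, \<open>P\<close> itself absorbs
    \<open>x\<close>.\<close>
  define K where "K = {y \<in> carrier R. \<forall>r\<in>carrier R. a \<otimes> r \<otimes> y \<in> P}"
  have "ideal K R"
  proof (rule ideal_closedI)
    fix y x assume y: "y \<in> K" and x: "x \<in> carrier R"
    have "a \<otimes> (r \<otimes> x) \<otimes> y \<in> P" "a \<otimes> r \<otimes> y \<otimes> x \<in> P" if "r \<in> carrier R" for r
      using x y that I_r_closed by (auto simp: K_def)
    then show "x \<otimes> y \<in> K" "y \<otimes> x \<in> K"
      using a x y by (auto simp: K_def m_assoc)
  qed (use a in \<open>auto simp: K_def r_distr\<close>)
  moreover have "b \<in> K"
    using b ab by (simp add: K_def)
  ultimately have J: "Idl {b} \<subseteq> K"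
    by (intro genideal_minimal) auto
  \<comment> \<open>The mirror image of \<open>K\<close>, with the whole ideal
    \<open>Idl {b}\<close> in place of the single element; \<open>Idl {b} \<subseteq> K\<close> says
    exactly that \<open>a\<close> belongs to it.\<close>
  define H where "H = {x \<in> carrier R. \<forall>r\<in>carrier R. \<forall>y\<in>Idl {b}. x \<otimes> r \<otimes> y \<in> P}"
  have bR: "y \<in> carrier R" if "y \<in> Idl {b}" for y
    using J that by (auto simp: K_def)
  have "ideal H R"
  proof (rule ideal_closedI)
    fix y x assume y: "y \<in> H" and x: "x \<in> carrier R"
    have "x \<otimes> (y \<otimes> r \<otimes> z) \<in> P" "y \<otimes> (x \<otimes> r) \<otimes> z \<in> P"
      if "r \<in> carrier R" "z \<in> Idl {b}" for r z
      using x y that I_l_closed by (auto simp: H_def)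
    then show "x \<otimes> y \<in> H" "y \<otimes> x \<in> H"
      using x y bR by (auto simp: H_def m_assoc)
  qed (use bR in \<open>auto simp: H_def l_distr\<close>)
  moreover have "a \<in> H"
    using a J by (auto simp: H_def K_def)
  ultimately have I: "Idl {a} \<subseteq> H"
    by (intro genideal_minimal) auto
  have "ideal_prod R (Idl {a}) (Idl {b}) \<subseteq> P"
  proof
    fix z assume "z \<in> ideal_prod R (Idl {a}) (Idl {b})"
    then show "z \<in> P"
    proof induct
      case (prod i j)
      then have "i \<in> carrier R" "i \<otimes> \<one> \<otimes> j \<in> P"
        using I by (auto simp: H_def)
      then show ?case
        by simp
    qed simp
  qed
  then have "Idl {a} \<subseteq> P \<or> Idl {b} \<subseteq> P"
    using P genideal_ideal a b by (simp add: prime_two_sided_ideal_def)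
  then show ?thesis
    using genideal_self'[OF a] genideal_self'[OF b] by blast
qed

text \<open>If neither \<open>I\<close> nor \<open>J\<close> were inside \<open>P\<close>, elements
  \<open>a\<close> of \<open>I\<close> and \<open>b\<close> of \<open>J\<close> outside
  \<open>P\<close> would have all \<open>a r b\<close> in the ideal product, hence in
  \<open>P\<close>, against the elementwise test.\<close>

lemma prime_two_sided_idealI:
  fixes R (structure)
  assumes "ideal P R" "P \<noteq> carrier R"
    and prime: "\<And>a b. a \<in> carrier R \<Longrightarrow> b \<in> carrier R \<Longrightarrow>
      (\<And>r. r \<in> carrier R \<Longrightarrow> a \<otimes> r \<otimes> b \<in> P) \<Longrightarrow> a \<in> P \<or> b \<in> P"
  shows "prime_two_sided_ideal P R"
  unfolding prime_two_sided_ideal_def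
proof (intro conjI allI impI)
  fix I J assume I: "ideal I R" and J: "ideal J R" and IJ: "ideal_prod R I J \<subseteq> P"
  show "I \<subseteq> P \<or> J \<subseteq> P"
  proof (rule ccontr)
    assume "\<not> (I \<subseteq> P \<or> J \<subseteq> P)"
    then obtain a b where ab: "a \<in> I" "a \<notin> P" "b \<in> J" "b \<notin> P"
      by blast
    have "a \<otimes> r \<otimes> b \<in> P" if "r \<in> carrier R" for r
      using that ab IJ ideal_prod.prod[of "a \<otimes> r" I b J R] ideal.I_r_closed[OF I] by blast
    with prime[of a b] ab show False
      using ideal.Icarr[OF I] ideal.Icarr[OF J] by blast
  qed
qed (use assms in auto)

text \<open>Noncommutative primes need not contract to primes: the elementwise test in
  \<open>S\<close> puts arbitrary \<open>s\<close> between \<open>h a\<close> and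
  \<open>h b\<close>, not only images of \<open>R\<close>. The hypothesis \<open>spread\<close>
  bridges this gap; it is verified separately for each of the two inclusions used below.\<close>

lemma (in ring_hom_ring) prime_two_sided_ideal_vimage:
  assumes Q: "prime_two_sided_ideal Q S"
    and spread: "\<And>a b s. a \<in> carrier R \<Longrightarrow> b \<in> carrier R \<Longrightarrow> s \<in> carrier S \<Longrightarrow>
      (\<And>r. r \<in> carrier R \<Longrightarrow> h (a \<otimes>\<^bsub>R\<^esub> r \<otimes>\<^bsub>R\<^esub> b) \<in> Q) \<Longrightarrow> h a \<otimes>\<^bsub>S\<^esub> s \<otimes>\<^bsub>S\<^esub> h b \<in> Q"
  shows "prime_two_sided_ideal {a \<in> carrier R. h a \<in> Q} R"
proof (rule prime_two_sided_idealI)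
  have Q': "ideal Q S" "Q \<noteq> carrier S"
    using Q by (auto simp: prime_two_sided_ideal_def)
  then show "ideal {a \<in> carrier R. h a \<in> Q} R"
    by (intro ideal_vimage)
  have "\<one>\<^bsub>S\<^esub> \<notin> Q"
    using Q' ideal.one_imp_carrier by blast
  then show "{a \<in> carrier R. h a \<in> Q} \<noteq> carrier R"
    using R.one_closed hom_one by force
  fix a b assume ab: "a \<in> carrier R" "b \<in> carrier R"
    and "\<And>r. r \<in> carrier R \<Longrightarrow> a \<otimes>\<^bsub>R\<^esub> r \<otimes>\<^bsub>R\<^esub> b \<in> {a \<in> carrier R. h a \<in> Q}"
  then have "h a \<otimes>\<^bsub>S\<^esub> s \<otimes>\<^bsub>S\<^esub> h b \<in> Q" if "s \<in> carrier S" for s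
    using that by (intro spread) auto
  then have "h a \<in> Q \<or> h b \<in> Q"
    by (intro prime_two_sided_idealD[OF Q]) (use ab in auto)
  with ab show "a \<in> {a \<in> carrier R. h a \<in> Q} \<or> b \<in> {a \<in> carrier R. h a \<in> Q}"
    by simp
qed

section \<open>Laurent polynomials as shifted polynomials\<close>

text \<open>The Laurent polynomial \<open>x\<^sup>-\<^sup>k F\<close>.\<close>

definition laurent_shift :: "('a, 'm) ring_scheme \<Rightarrow> int \<Rightarrow> (nat \<Rightarrow> 'a) \<Rightarrow> int \<Rightarrow> 'a" where
  "laurent_shift R k F = (\<lambda>n. if n + k < 0 then \<zero>\<^bsub>R\<^esub> else F (nat (n + k)))"

context ring
begin

lemma UP_is_ring: "ring (UP R)"
  by (rule UP_ring.UP_ring) (simp add: UP_ring_def ring_axioms)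

lemma UP_carrier: "carrier (UP R) = up R"
  by (simp add: UP_def)

lemma Laurent_carrier: "p \<in> carrier (Laurent R) \<longleftrightarrow> (\<forall>n. p n \<in> carrier R) \<and> finite {n. p n \<noteq> \<zero>}"
  by (auto simp: Laurent_def laurent_carrier_def)

lemma Laurent_add: "p \<oplus>\<^bsub>Laurent R\<^esub> q = (\<lambda>n. p n \<oplus> q n)"
  and Laurent_zero: "\<zero>\<^bsub>Laurent R\<^esub> = (\<lambda>n. \<zero>)"
  and Laurent_one: "\<one>\<^bsub>Laurent R\<^esub> = (\<lambda>n. if n = 0 then \<one> else \<zero>)"
  by (simp_all add: Laurent_def)

text \<open>Frees the convolution from the support of \<open>p\<close>, so that it can be taken over
  an interval, over a single exponent, or over the support with one exponent split off.\<close>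

lemma Laurent_mult:
  assumes p: "p \<in> carrier (Laurent R)" and q: "q \<in> carrier (Laurent R)" and A: "finite A"
    and out: "\<And>i. i \<notin> A \<Longrightarrow> p i \<otimes> q (n - i) = \<zero>"
  shows "(p \<otimes>\<^bsub>Laurent R\<^esub> q) n = (\<Oplus>i\<in>A. p i \<otimes> q (n - i))"
proof -
  have "(p \<otimes>\<^bsub>Laurent R\<^esub> q) n = (\<Oplus>i\<in>{i. p i \<noteq> \<zero>}. p i \<otimes> q (n - i))"
    by (simp add: Laurent_def)
  also have "\<dots> = (\<Oplus>i\<in>A. p i \<otimes> q (n - i))"
    using p q A out by (intro add.finprod_mono_neutral_cong) (auto simp: Laurent_carrier)
  finally show ?thesis .
qed

lemma laurent_shift_closed:
  assumes "F \<in> up R"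
  shows "laurent_shift R k F \<in> carrier (Laurent R)"
proof -
  obtain m where m: "bound \<zero> m F"
    using assms by auto
  have "{n. laurent_shift R k F n \<noteq> \<zero>} \<subseteq> {-k..int m - k}"
  proof
    fix n assume "n \<in> {n. laurent_shift R k F n \<noteq> \<zero>}"
    then have "0 \<le> n + k" "F (nat (n + k)) \<noteq> \<zero>"
      by (auto simp: laurent_shift_def split: if_splits)
    moreover from this have "nat (n + k) \<le> m"
      using m by (meson bound_def not_le)
    ultimately show "n \<in> {-k..int m - k}"
      by auto
  qed
  then have "finite {n. laurent_shift R k F n \<noteq> \<zero>}"
    by (rule finite_subset) simp
  then show ?thesis
    using assms by (auto simp: Laurent_carrier laurent_shift_def)
qed

text \<open>Clearing of denominators. It is stated for all large \<open>k\<close>, not for one, so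
  that two Laurent polynomials can be given the same shift.\<close>

lemma laurent_shift_surj:
  assumes "p \<in> carrier (Laurent R)"
  shows "\<exists>k0. \<forall>k\<ge>k0. \<exists>F\<in>up R. p = laurent_shift R k F"
proof -
  \<comment> \<open>A crude bound on every exponent of \<open>p\<close>; unlike a maximum, it also
    makes sense for an empty support.\<close>
  define k0 where "k0 = (\<Sum>n\<in>{n. p n \<noteq> \<zero>}. \<bar>n\<bar>)"
  have k0: "\<bar>n\<bar> \<le> k0" if "p n \<noteq> \<zero>" for n
    unfolding k0_def using assms that
    by (intro member_le_sum[where f = abs]) (auto simp: Laurent_carrier)
  show ?thesis
  proof (intro exI allI impI)
    fix k assume k: "k0 \<le> k"
    have "(\<lambda>n. p (int n - k)) \<in> up R"
    proof
      \<comment> \<open>A nonzero coefficient forces \<open>int n - k \<le> k0 \<le> k\<close>, so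
        its index is at most \<open>2 * k\<close>.\<close>
      have "p (int n - k) = \<zero>" if "nat (2 * \<bar>k\<bar>) < n" for n
        using k0[of "int n - k"] k that by force
      then show "\<exists>n. bound \<zero> n (\<lambda>n. p (int n - k))"
        by (intro exI[of _ "nat (2 * \<bar>k\<bar>)"] bound.intro) auto
    qed (use assms in \<open>auto simp: Laurent_carrier\<close>)
    moreover have "p = laurent_shift R k (\<lambda>n. p (int n - k))"
      using k0 k by (fastforce simp: laurent_shift_def fun_eq_iff)
    ultimately show "\<exists>F\<in>up R. p = laurent_shift R k F"
      by blast
  qed
qed

lemma laurent_shift_add:
  assumes "F \<in> up R" "G \<in> up R"
  shows "laurent_shift R k F \<oplus>\<^bsub>Laurent R\<^esub> laurent_shift R k G = laurent_shift R k (F \<oplus>\<^bsub>UP R\<^esub> G)"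
  using assms by (auto simp: laurent_shift_def Laurent_add UP_def)

text \<open>The terms that can be nonzero at exponent \<open>n\<close> lie in a finite interval, and
  translating it by \<open>k\<close> gives the index range \<open>{..N}\<close> of the polynomial
  product, with \<open>N = n + k + l\<close>.\<close>

lemma laurent_shift_mult:
  assumes F: "F \<in> up R" and G: "G \<in> up R"
  shows "laurent_shift R k F \<otimes>\<^bsub>Laurent R\<^esub> laurent_shift R l G = laurent_shift R (k + l) (F \<otimes>\<^bsub>UP R\<^esub> G)"
proof
  fix n
  define N where "N = nat (n + k + l)"
  have "(laurent_shift R k F \<otimes>\<^bsub>Laurent R\<^esub> laurent_shift R l G) n
      = (\<Oplus>i\<in>{-k..n+l}. laurent_shift R k F i \<otimes> laurent_shift R l G (n - i))"
    using F G
    by (intro Laurent_mult laurent_shift_closed) (auto simp: laurent_shift_def mem_upD)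
  also have "\<dots> = laurent_shift R (k + l) (F \<otimes>\<^bsub>UP R\<^esub> G) n"
  proof (cases "n + k + l < 0")
    case True
    then have "{-k..n+l} = {}"
      by auto
    with True show ?thesis
      by (simp add: laurent_shift_def algebra_simps)
  next
    case False
    then have N: "int N = n + k + l"
      by (simp add: N_def)
    have im: "{-k..n+l} = (\<lambda>i. int i - k) ` {..N}"
    proof (intro equalityI subsetI)
      fix i assume "i \<in> {-k..n+l}"
      then show "i \<in> (\<lambda>i. int i - k) ` {..N}"
        using N by (intro image_eqI[of _ _ "nat (i + k)"]) auto
    qed (use N in auto)
    have "(\<Oplus>i\<in>{-k..n+l}. laurent_shift R k F i \<otimes> laurent_shift R l G (n - i))
      = (\<Oplus>i\<in>{..N}. laurent_shift R k F (int i - k) \<otimes> laurent_shift R l G (n - (int i - k)))"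
      unfolding im using laurent_shift_closed[OF F] laurent_shift_closed[OF G]
      by (intro finsum_reindex) (auto simp: Laurent_carrier inj_on_def)
    also have "\<dots> = (\<Oplus>i\<in>{..N}. F i \<otimes> G (N - i))"
    proof (rule finsum_cong')
      fix i assume "i \<in> {..N}"
      moreover from this have "nat (n - (int i - k) + l) = N - i"
        using N by auto
      ultimately show "laurent_shift R k F (int i - k) \<otimes> laurent_shift R l G (n - (int i - k)) = F i \<otimes> G (N - i)"
        using N by (auto simp: laurent_shift_def)
    qed (use F G in auto)
    also have "\<dots> = laurent_shift R (k + l) (F \<otimes>\<^bsub>UP R\<^esub> G) n"
      using False F G by (simp add: laurent_shift_def UP_def N_def algebra_simps)
    finally show ?thesis .
  qed
  finally show "(laurent_shift R k F \<otimes>\<^bsub>Laurent R\<^esub> laurent_shift R l G) n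
    = laurent_shift R (k + l) (F \<otimes>\<^bsub>UP R\<^esub> G) n" .
qed

lemma laurent_shift_one: "laurent_shift R 0 \<one>\<^bsub>UP R\<^esub> = \<one>\<^bsub>Laurent R\<^esub>"
  by (auto simp: laurent_shift_def Laurent_one UP_def)

lemma laurent_shift_zero_iff:
  "laurent_shift R k F = \<zero>\<^bsub>Laurent R\<^esub> \<longleftrightarrow> F = \<zero>\<^bsub>UP R\<^esub>"
proof
  assume "laurent_shift R k F = \<zero>\<^bsub>Laurent R\<^esub>"
  then have "laurent_shift R k F (int n - k) = \<zero>" for n
    by (simp add: Laurent_zero)
  then show "F = \<zero>\<^bsub>UP R\<^esub>"
    by (simp add: laurent_shift_def UP_def fun_eq_iff)
qed (auto simp: laurent_shift_def UP_def Laurent_zero)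

text \<open>Via \<open>laurent_shift\<close> the multiplicative laws are inherited from \<open>UP R\<close>.\<close>

theorem Laurent_is_ring: "ring (Laurent R)"
proof -
  interpret UP: ring "UP R"
    by (rule UP_is_ring)
  note closed = UP.m_closed UP.a_closed UP.one_closed
  note [simp] = closed[unfolded UP_carrier] laurent_shift_mult laurent_shift_add laurent_shift_closed
  \<comment> \<open>Sums need both operands over the same power of \<open>x\<close>, because
    \<open>laurent_shift_add\<close> keeps one shift. For products separate shifts suffice, as they
    add up.\<close>
  have common: "\<exists>k F G. F \<in> up R \<and> G \<in> up R \<and> p = laurent_shift R k F \<and> q = laurent_shift R k G"
    if p: "p \<in> carrier (Laurent R)" and q: "q \<in> carrier (Laurent R)" for p q
  proof -
    obtain k where "\<forall>i\<ge>k. \<exists>F\<in>up R. p = laurent_shift R i F"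
      using laurent_shift_surj[OF p] ..
    moreover obtain l where "\<forall>i\<ge>l. \<exists>F\<in>up R. q = laurent_shift R i F"
      using laurent_shift_surj[OF q] ..
    ultimately show ?thesis
      by (meson max.cobounded1 max.cobounded2)
  qed
  have single: "\<exists>k F. F \<in> up R \<and> p = laurent_shift R k F" if "p \<in> carrier (Laurent R)" for p
    using common[OF that that] by blast
  show ?thesis
  proof (intro ringI abelian_groupI monoidI)
    fix p q assume pq: "p \<in> carrier (Laurent R)" "q \<in> carrier (Laurent R)"
    show "p \<oplus>\<^bsub>Laurent R\<^esub> q \<in> carrier (Laurent R)"
      using common[OF pq] by auto
    show "p \<otimes>\<^bsub>Laurent R\<^esub> q \<in> carrier (Laurent R)"
      using common[OF pq] by auto
    show "p \<oplus>\<^bsub>Laurent R\<^esub> q = q \<oplus>\<^bsub>Laurent R\<^esub> p"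
      using pq by (auto simp: Laurent_add Laurent_carrier a_comm)
    fix r assume r: "r \<in> carrier (Laurent R)"
    show "p \<oplus>\<^bsub>Laurent R\<^esub> q \<oplus>\<^bsub>Laurent R\<^esub> r = p \<oplus>\<^bsub>Laurent R\<^esub> (q \<oplus>\<^bsub>Laurent R\<^esub> r)"
      using pq r by (auto simp: Laurent_add Laurent_carrier a_assoc)
    show "p \<otimes>\<^bsub>Laurent R\<^esub> q \<otimes>\<^bsub>Laurent R\<^esub> r = p \<otimes>\<^bsub>Laurent R\<^esub> (q \<otimes>\<^bsub>Laurent R\<^esub> r)"
      using single[OF pq(1)] single[OF pq(2)] single[OF r]
      by (auto simp: UP.m_assoc[unfolded UP_carrier] add_ac)
    show "(p \<oplus>\<^bsub>Laurent R\<^esub> q) \<otimes>\<^bsub>Laurent R\<^esub> r = p \<otimes>\<^bsub>Laurent R\<^esub> r \<oplus>\<^bsub>Laurent R\<^esub> q \<otimes>\<^bsub>Laurent R\<^esub> r"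
      using common[OF pq] single[OF r] by (auto simp: UP.l_distr[unfolded UP_carrier])
    show "r \<otimes>\<^bsub>Laurent R\<^esub> (p \<oplus>\<^bsub>Laurent R\<^esub> q) = r \<otimes>\<^bsub>Laurent R\<^esub> p \<oplus>\<^bsub>Laurent R\<^esub> r \<otimes>\<^bsub>Laurent R\<^esub> q"
      using common[OF pq] single[OF r] by (auto simp: UP.r_distr[unfolded UP_carrier])
  next
    fix p assume p: "p \<in> carrier (Laurent R)"
    show "\<one>\<^bsub>Laurent R\<^esub> \<otimes>\<^bsub>Laurent R\<^esub> p = p"
      using single[OF p] by (auto simp: UP.l_one[unfolded UP_carrier] simp flip: laurent_shift_one)
    show "p \<otimes>\<^bsub>Laurent R\<^esub> \<one>\<^bsub>Laurent R\<^esub> = p"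
      using single[OF p] by (auto simp: UP.r_one[unfolded UP_carrier] simp flip: laurent_shift_one)
    show "\<zero>\<^bsub>Laurent R\<^esub> \<oplus>\<^bsub>Laurent R\<^esub> p = p"
      using p by (auto simp: Laurent_add Laurent_zero Laurent_carrier)
    have "{n. \<ominus> p n \<noteq> \<zero>} \<subseteq> {n. p n \<noteq> \<zero>}"
      by auto
    then have "(\<lambda>n. \<ominus> p n) \<in> carrier (Laurent R)"
      using p by (auto simp: Laurent_carrier intro: finite_subset)
    moreover have "(\<lambda>n. \<ominus> p n) \<oplus>\<^bsub>Laurent R\<^esub> p = \<zero>\<^bsub>Laurent R\<^esub>"
      using p by (auto simp: Laurent_add Laurent_zero Laurent_carrier l_neg)
    ultimately show "\<exists>q\<in>carrier (Laurent R). q \<oplus>\<^bsub>Laurent R\<^esub> p = \<zero>\<^bsub>Laurent R\<^esub>"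
      by blast
  qed (auto simp: Laurent_zero Laurent_one Laurent_carrier)
qed

lemma laurent_shift_hom: "ring_hom_ring (UP R) (Laurent R) (laurent_shift R 0)"
proof (rule ring_hom_ringI2[OF UP_is_ring Laurent_is_ring])
  show "laurent_shift R 0 \<in> ring_hom (UP R) (Laurent R)"
    by (auto simp: ring_hom_def UP_carrier laurent_shift_closed laurent_shift_mult
        laurent_shift_add laurent_shift_one)
qed

lemma monom_hom: "ring_hom_ring R (UP R) (\<lambda>a. monom (UP R) a 0)"
proof -
  interpret U: UP_ring R "UP R"
    by (simp add: UP_ring_def ring_axioms)
  show ?thesis
  proof (rule ring_hom_ringI2[OF ring_axioms UP_is_ring ring_hom_memI])
    show "monom (UP R) (a \<otimes> b) 0 = monom (UP R) a 0 \<otimes>\<^bsub>UP R\<^esub> monom (UP R) b 0"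
      if "a \<in> carrier R" "b \<in> carrier R" for a b
      using that U.monom_mult[of a b 0 0] by simp
    show "monom (UP R) \<one> 0 = \<one>\<^bsub>UP R\<^esub>"
      by simp
  qed simp_all
qed

section \<open>Contraction and extension of primes\<close>

text \<open>The two shifts of \<open>F\<close> differ by the factor \<open>x^(k - l)\<close>, a
  Laurent polynomial that \<open>Q\<close> absorbs.\<close>

lemma laurent_shift_mem_ideal:
  assumes Q: "ideal Q (Laurent R)" and F: "F \<in> up R" and mem: "laurent_shift R k F \<in> Q"
  shows "laurent_shift R l F \<in> Q"
proof -
  interpret UP: ring "UP R"
    by (rule UP_is_ring)
  have one: "\<one>\<^bsub>UP R\<^esub> \<in> up R"
    using UP.one_closed by (simp add: UP_carrier)
  have "laurent_shift R (l - k) \<one>\<^bsub>UP R\<^esub> \<otimes>\<^bsub>Laurent R\<^esub> laurent_shift R k F \<in> Q"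
    using Q mem laurent_shift_closed[OF one] by (rule ideal.I_l_closed)
  then show ?thesis
    using F one by (simp add: laurent_shift_mult UP.l_one[unfolded UP_carrier])
qed

text \<open>Clearing denominators turns the relation into one between polynomials. Its conclusion
  holds in the contraction of every prime \<open>Q\<close>, and shifting back stays inside
  \<open>Q\<close>.\<close>

lemma P_symmetric_UP_imp_Laurent:
  assumes "P_symmetric (UP R)"
  shows "P_symmetric (Laurent R)"
  unfolding P_symmetric_def
proof (intro ballI impI)
  interpret UP: ring "UP R"
    by (rule UP_is_ring)
  interpret L: ring "Laurent R"
    by (rule Laurent_is_ring)
  note [simp] = UP.m_closed[unfolded UP_carrier] laurent_shift_mult laurent_shift_closed
  fix f g h
  assume fgh: "f \<in> carrier (Laurent R)" "g \<in> carrier (Laurent R)" "h \<in> carrier (Laurent R)"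
    and 0: "f \<otimes>\<^bsub>Laurent R\<^esub> g \<otimes>\<^bsub>Laurent R\<^esub> h = \<zero>\<^bsub>Laurent R\<^esub>"
  obtain k l m F G H where FGH [simp]: "F \<in> up R" "G \<in> up R" "H \<in> up R"
    and [simp]: "f = laurent_shift R k F" "g = laurent_shift R l G" "h = laurent_shift R m H"
    using fgh laurent_shift_surj by (metis order_refl)
  have "F \<otimes>\<^bsub>UP R\<^esub> G \<otimes>\<^bsub>UP R\<^esub> H = \<zero>\<^bsub>UP R\<^esub>"
    using 0 by (simp add: laurent_shift_zero_iff)
  then have rad: "G \<otimes>\<^bsub>UP R\<^esub> F \<otimes>\<^bsub>UP R\<^esub> H \<in> prime_radical (UP R)"
    using assms by (simp add: P_symmetric_def UP_carrier)
  have "g \<otimes>\<^bsub>Laurent R\<^esub> f \<otimes>\<^bsub>Laurent R\<^esub> h \<in> Q" if Q: "prime_two_sided_ideal Q (Laurent R)" for Q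
  proof -
    have idl: "ideal Q (Laurent R)"
      using Q by (rule prime_two_sided_ideal_imp_ideal)
    interpret hom: ring_hom_ring "UP R" "Laurent R" "laurent_shift R 0"
      by (rule laurent_shift_hom)
    have "prime_two_sided_ideal {a \<in> carrier (UP R). laurent_shift R 0 a \<in> Q} (UP R)"
    proof (rule hom.prime_two_sided_ideal_vimage[OF Q])
      fix a b s
      assume ab: "a \<in> carrier (UP R)" "b \<in> carrier (UP R)" and s: "s \<in> carrier (Laurent R)"
        and Qr: "\<And>r. r \<in> carrier (UP R) \<Longrightarrow> laurent_shift R 0 (a \<otimes>\<^bsub>UP R\<^esub> r \<otimes>\<^bsub>UP R\<^esub> b) \<in> Q"
      obtain j S where S: "S \<in> up R" "s = laurent_shift R j S"
        using s laurent_shift_surj by (metis order_refl)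
      \<comment> \<open>This is the \<open>spread\<close> condition: the numerator \<open>S\<close>
        of \<open>s\<close> is an admissible middle factor in R[x], and restoring the denominator
        \<open>x^j\<close> does not leave \<open>Q\<close>.\<close>
      have "laurent_shift R j (a \<otimes>\<^bsub>UP R\<^esub> S \<otimes>\<^bsub>UP R\<^esub> b) \<in> Q"
        by (rule laurent_shift_mem_ideal[OF idl _ Qr]) (use ab S in \<open>simp_all add: UP_carrier\<close>)
      then show "laurent_shift R 0 a \<otimes>\<^bsub>Laurent R\<^esub> s \<otimes>\<^bsub>Laurent R\<^esub> laurent_shift R 0 b \<in> Q"
        using ab S by (simp add: UP_carrier)
    qed
    then have "laurent_shift R 0 (G \<otimes>\<^bsub>UP R\<^esub> F \<otimes>\<^bsub>UP R\<^esub> H) \<in> Q"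
      using rad by (auto simp: prime_radical_def)
    then have "laurent_shift R (l + k + m) (G \<otimes>\<^bsub>UP R\<^esub> F \<otimes>\<^bsub>UP R\<^esub> H) \<in> Q"
      by (rule laurent_shift_mem_ideal[OF idl, rotated]) simp
    then show ?thesis
      by simp
  qed
  then show "g \<otimes>\<^bsub>Laurent R\<^esub> f \<otimes>\<^bsub>Laurent R\<^esub> h \<in> prime_radical (Laurent R)"
    using fgh by (simp add: prime_radical_def)
qed

section \<open>Extending primes of \<open>R\<close> to Laurent polynomials, and descending to
  constants\<close>

definition laurent_const :: "'a \<Rightarrow> int \<Rightarrow> 'a" where
  "laurent_const a = (\<lambda>n. if n = 0 then a else \<zero>)"

lemma laurent_const_closed:
  "a \<in> carrier R \<Longrightarrow> laurent_const a \<in> carrier (Laurent R)"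
  by (auto simp: laurent_const_def Laurent_carrier)

lemma mult_laurent_const:
  assumes "p \<in> carrier (Laurent R)" "a \<in> carrier R"
  shows "(p \<otimes>\<^bsub>Laurent R\<^esub> laurent_const a) n = p n \<otimes> a"
proof -
  have "(p \<otimes>\<^bsub>Laurent R\<^esub> laurent_const a) n = (\<Oplus>i\<in>{n}. p i \<otimes> laurent_const a (n - i))"
    using assms by (intro Laurent_mult laurent_const_closed) (auto simp: laurent_const_def Laurent_carrier)
  then show ?thesis
    using assms by (simp add: laurent_const_def Laurent_carrier)
qed

text \<open>Leading coefficients modulo \<open>P\<close>: if \<open>i\<close> and \<open>j\<close>
  are the highest exponents at which \<open>f\<close> and \<open>g\<close> leave \<open>P\<close>,
  then the coefficient of \<open>f r g\<close> at \<open>i + j\<close> is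
  \<open>f i \<otimes> r \<otimes> g j\<close> up to elements of \<open>P\<close>. Hence
  \<open>f i\<close> and \<open>g j\<close> would violate the primeness of \<open>P\<close>.\<close>

lemma prime_two_sided_ideal_Laurent:
  assumes P: "prime_two_sided_ideal P R"
  shows "prime_two_sided_ideal {p \<in> carrier (Laurent R). \<forall>n. p n \<in> P} (Laurent R)" (is "prime_two_sided_ideal ?Q _")
proof (rule prime_two_sided_idealI)
  interpret P: ideal P R
    using P by (rule prime_two_sided_ideal_imp_ideal)
  interpret L: ring "Laurent R"
    by (rule Laurent_is_ring)
  have mult: "(p \<otimes>\<^bsub>Laurent R\<^esub> q) n = (\<Oplus>i\<in>{i. p i \<noteq> \<zero>}. p i \<otimes> q (n - i))" for p q n
    by (simp add: Laurent_def)
  show "ideal ?Q (Laurent R)"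
  proof (rule L.ideal_closedI)
    fix p q assume p: "p \<in> ?Q" and q: "q \<in> carrier (Laurent R)"
    have "p n \<in> P" "q n \<in> carrier R" for n
      using p q by (auto simp: Laurent_carrier)
    then have "q i \<otimes> p n \<in> P" "p n \<otimes> q i \<in> P" for i n
      by (auto intro: P.I_l_closed P.I_r_closed)
    then show "q \<otimes>\<^bsub>Laurent R\<^esub> p \<in> ?Q" "p \<otimes>\<^bsub>Laurent R\<^esub> q \<in> ?Q"
      using p q L.m_closed by (auto simp: mult intro: P.finsum_mem)
  qed (auto simp: Laurent_zero Laurent_add intro: L.a_closed[unfolded Laurent_add] L.zero_closed[unfolded Laurent_zero])
  have "\<one> \<notin> P"
    using P P.one_imp_carrier by (auto simp: prime_two_sided_ideal_def)
  then have "\<one>\<^bsub>Laurent R\<^esub> \<notin> ?Q"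
    by (auto simp: Laurent_one intro!: exI[of _ 0])
  then show "?Q \<noteq> carrier (Laurent R)"
    using L.one_closed by blast
  fix f g assume f: "f \<in> carrier (Laurent R)" and g: "g \<in> carrier (Laurent R)"
    and fg: "\<And>r. r \<in> carrier (Laurent R) \<Longrightarrow> f \<otimes>\<^bsub>Laurent R\<^esub> r \<otimes>\<^bsub>Laurent R\<^esub> g \<in> ?Q"
  \<comment> \<open>The exponents with coefficient outside \<open>P\<close> lie in the support,
    since \<open>\<zero>\<close> is in \<open>P\<close>; so a largest one exists.\<close>
  have top: "\<exists>i. p i \<notin> P \<and> (\<forall>j>i. p j \<in> P)" if "p \<in> carrier (Laurent R)" "p \<notin> ?Q" for p
  proof -
    have fin: "finite {i. p i \<notin> P}"
      using that(1) by (auto simp: Laurent_carrier intro: finite_subset[rotated])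
    moreover have "{i. p i \<notin> P} \<noteq> {}"
      using that by auto
    ultimately have "Max {i. p i \<notin> P} \<in> {i. p i \<notin> P}"
      by (rule Max_in)
    moreover have "p j \<in> P" if "j > Max {i. p i \<notin> P}" for j
      using that Max_ge[OF fin, of j] by force
    ultimately show ?thesis
      by blast
  qed
  show "f \<in> ?Q \<or> g \<in> ?Q"
  proof (rule ccontr)
    assume "\<not> (f \<in> ?Q \<or> g \<in> ?Q)"
    then obtain i j where i: "f i \<notin> P" "\<forall>i'>i. f i' \<in> P" and j: "g j \<notin> P" "\<forall>j'>j. g j' \<in> P"
      using top f g by meson
    have carr: "f n \<in> carrier R" "g n \<in> carrier R" for n
      using f g by (auto simp: Laurent_carrier)
    have "f i \<otimes> r \<otimes> g j \<in> P" if r: "r \<in> carrier R" for r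
    proof -
      \<comment> \<open>The exponents that contribute besides \<open>i\<close>. For
        \<open>n > i\<close> the coefficient of \<open>f\<close> is in \<open>P\<close>; for
        \<open>n < i\<close> the partner exponent \<open>i + j - n\<close> exceeds \<open>j\<close>,
        so that of \<open>g\<close> is.\<close>
      define A where "A = {n. f n \<noteq> \<zero>} - {i}"
      let ?t = "\<lambda>n. f n \<otimes> r \<otimes> g (i + j - n)"
      have A: "finite A"
        using f by (simp add: A_def Laurent_carrier)
      have "(f \<otimes>\<^bsub>Laurent R\<^esub> laurent_const r \<otimes>\<^bsub>Laurent R\<^esub> g) (i + j)
          = (\<Oplus>n\<in>insert i A. (f \<otimes>\<^bsub>Laurent R\<^esub> laurent_const r) n \<otimes> g (i + j - n))"
        by (rule Laurent_mult)
          (use A f g r carr in \<open>auto simp: A_def mult_laurent_const intro!: laurent_const_closed\<close>)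
      also have "\<dots> = ?t i \<oplus> (\<Oplus>n\<in>A. ?t n)"
        using A f r carr by (subst finsum_insert) (auto simp: A_def mult_laurent_const)
      finally have "?t i \<oplus> (\<Oplus>n\<in>A. ?t n) = (f \<otimes>\<^bsub>Laurent R\<^esub> laurent_const r \<otimes>\<^bsub>Laurent R\<^esub> g) (i + j)" ..
      also have "\<dots> \<in> P"
        using fg[OF laurent_const_closed[OF r]] by blast
      finally have "?t i \<oplus> (\<Oplus>n\<in>A. ?t n) \<in> P" .
      moreover have "(\<Oplus>n\<in>A. ?t n) \<in> P"
      proof (rule P.finsum_mem)
        fix n assume "n \<in> A"
        then consider "n > i" | "i + j - n > j"
          by (fastforce simp: A_def)
        then show "?t n \<in> P"
          using i j r carr by cases (auto simp: P.I_l_closed P.I_r_closed)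
      qed
      ultimately have "?t i \<in> P"
        by (rule P.add_mem_cancel) (use r carr in auto)
      then show ?thesis
        by simp
    qed
    then have "f i \<in> P \<or> g j \<in> P"
      using carr by (intro prime_two_sided_idealD[OF P])
    with i j show False
      by simp
  qed
qed

text \<open>Constants carry the relation into the Laurent ring. Each prime \<open>P\<close> is
  tested through its extension, where the coefficient at exponent \<open>0\<close> gives back
  membership in \<open>P\<close>.\<close>

lemma P_symmetric_Laurent_imp_base:
  assumes "P_symmetric (Laurent R)"
  shows "P_symmetric R"
  unfolding P_symmetric_def
proof (intro ballI impI)
  fix a b c assume abc: "a \<in> carrier R" "b \<in> carrier R" "c \<in> carrier R" and 0: "a \<otimes> b \<otimes> c = \<zero>"
  interpret L: ring "Laurent R"
    by (rule Laurent_is_ring)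
  have mult: "laurent_const u \<otimes>\<^bsub>Laurent R\<^esub> laurent_const v = laurent_const (u \<otimes> v)"
    if "u \<in> carrier R" "v \<in> carrier R" for u v
    using that by (auto simp: fun_eq_iff mult_laurent_const laurent_const_closed) (auto simp: laurent_const_def)
  have "laurent_const a \<otimes>\<^bsub>Laurent R\<^esub> laurent_const b \<otimes>\<^bsub>Laurent R\<^esub> laurent_const c = \<zero>\<^bsub>Laurent R\<^esub>"
    using abc 0 by (simp add: mult) (simp add: laurent_const_def Laurent_zero)
  then have "laurent_const b \<otimes>\<^bsub>Laurent R\<^esub> laurent_const a \<otimes>\<^bsub>Laurent R\<^esub> laurent_const c \<in> prime_radical (Laurent R)"
    using assms abc laurent_const_closed by (simp add: P_symmetric_def)
  then have rad: "laurent_const (b \<otimes> a \<otimes> c) \<in> prime_radical (Laurent R)"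
    using abc by (simp add: mult)
  have "b \<otimes> a \<otimes> c \<in> P" if "prime_two_sided_ideal P R" for P
  proof -
    have "laurent_const (b \<otimes> a \<otimes> c) 0 \<in> P"
      using rad prime_two_sided_ideal_Laurent[OF that] by (auto simp: prime_radical_def)
    then show ?thesis
      by (simp add: laurent_const_def)
  qed
  then show "b \<otimes> a \<otimes> c \<in> prime_radical R"
    using abc by (simp add: prime_radical_def)
qed

section \<open>Contracting primes of R[x] to constants\<close>

lemma UP_mem_ideal:
  assumes Q: "ideal Q (UP R)" and f: "f \<in> carrier (UP R)"
    and coeffs: "\<And>n. monom (UP R) (coeff (UP R) f n) 0 \<in> Q"
  shows "f \<in> Q"
proof -
  interpret UP_ring R "UP R"
    by (simp add: UP_ring_def ring_axioms)
  interpret Q: ideal Q "UP R"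
    by fact
  have "monom (UP R) (coeff (UP R) f i) i \<in> Q" for i
  proof -
    have "monom (UP R) (coeff (UP R) f i) 0 \<otimes>\<^bsub>UP R\<^esub> monom (UP R) \<one> i \<in> Q"
      by (intro Q.I_r_closed coeffs monom_closed) simp
    also have "monom (UP R) (coeff (UP R) f i) 0 \<otimes>\<^bsub>UP R\<^esub> monom (UP R) \<one> i = monom (UP R) (coeff (UP R) f i) i"
      using f monom_mult[of "coeff (UP R) f i" \<one> 0 i] by (simp del: monom_mult)
    finally show ?thesis .
  qed
  then have "(\<Oplus>\<^bsub>UP R\<^esub>i\<in>{..deg R f}. monom (UP R) (coeff (UP R) f i) i) \<in> Q"
    by (rule Q.finsum_mem)
  then show ?thesis
    using up_repr[OF f] by simp
qed

text \<open>Since \<open>x\<close> is central, putting \<open>s\<close> between the constants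
  \<open>a\<close> and \<open>b\<close> turns each coefficient \<open>c\<close> of \<open>s\<close>
  into \<open>a \<otimes> c \<otimes> b\<close>. These are in \<open>Q\<close> as constants, so
  \<open>UP_mem_ideal\<close> puts the whole product there, which is the \<open>spread\<close>
  condition.\<close>

lemma prime_two_sided_ideal_constants:
  assumes Q: "prime_two_sided_ideal Q (UP R)"
  shows "prime_two_sided_ideal {a \<in> carrier R. monom (UP R) a 0 \<in> Q} R"
proof -
  interpret U: UP_ring R "UP R"
    by (simp add: UP_ring_def ring_axioms)
  interpret hom: ring_hom_ring R "UP R" "\<lambda>a. monom (UP R) a 0"
    by (rule monom_hom)
  show ?thesis
  proof (rule hom.prime_two_sided_ideal_vimage[OF Q])
    fix a b s assume ab: "a \<in> carrier R" "b \<in> carrier R" and s: "s \<in> carrier (UP R)"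
      and r: "\<And>r. r \<in> carrier R \<Longrightarrow> monom (UP R) (a \<otimes> r \<otimes> b) 0 \<in> Q"
    let ?p = "monom (UP R) a 0 \<otimes>\<^bsub>UP R\<^esub> s \<otimes>\<^bsub>UP R\<^esub> monom (UP R) b 0"
    have "coeff (UP R) ?p n = a \<otimes> coeff (UP R) s n \<otimes> b" for n
    proof -
      let ?c = "coeff (UP R) (a \<odot>\<^bsub>UP R\<^esub> s)"
      have "coeff (UP R) ?p n = (\<Oplus>i\<in>{..n}. ?c i \<otimes> coeff (UP R) (monom (UP R) b 0) (n - i))"
        using ab s by (simp add: U.monom_mult_is_smult del: U.coeff_smult U.coeff_monom)
      \<comment> \<open>The constant \<open>b\<close> has only a coefficient at \<open>0\<close>, so
        just the term \<open>i = n\<close> survives.\<close>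
      also have "\<dots> = (\<Oplus>i\<in>{..n}. if n = i then ?c i \<otimes> b else \<zero>)"
        using ab s by (intro finsum_cong') auto
      also have "\<dots> = ?c n \<otimes> b"
        using ab s by (intro add.finprod_singleton) auto
      finally show ?thesis
        using ab s by simp
    qed
    then have "monom (UP R) (coeff (UP R) ?p n) 0 \<in> Q" for n
      using s r by (simp only: U.coeff_closed)
    then show "?p \<in> Q"
      by (rule UP_mem_ideal[OF prime_two_sided_ideal_imp_ideal[OF Q], rotated]) (use ab s in simp)
  qed
qed

section \<open>Armendariz rings\<close>

text \<open>The condition is applied twice: to \<open>f\<close> and \<open>g h\<close>, so that each
  coefficient \<open>a\<close> of \<open>f\<close> kills \<open>g h\<close>; then to the scalar
  multiple \<open>a g\<close> and \<open>h\<close>.\<close>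

lemma Armendariz_triple:
  assumes A: "Armendariz R"
    and fgh: "f \<in> carrier (UP R)" "g \<in> carrier (UP R)" "h \<in> carrier (UP R)"
    and 0: "f \<otimes>\<^bsub>UP R\<^esub> g \<otimes>\<^bsub>UP R\<^esub> h = \<zero>\<^bsub>UP R\<^esub>"
  shows "coeff (UP R) f i \<otimes> coeff (UP R) g j \<otimes> coeff (UP R) h k = \<zero>"
proof -
  interpret U: UP_ring R "UP R"
    by (simp add: UP_ring_def ring_axioms)
  let ?a = "coeff (UP R) f i"
  have a: "?a \<in> carrier R"
    using fgh by simp
  have "f \<otimes>\<^bsub>UP R\<^esub> (g \<otimes>\<^bsub>UP R\<^esub> h) = \<zero>\<^bsub>UP R\<^esub>"
    using fgh 0 by (simp add: U.m_assoc)
  then have "?a \<otimes> coeff (UP R) (g \<otimes>\<^bsub>UP R\<^esub> h) n = \<zero>" for n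
    using A fgh unfolding Armendariz_def by (meson U.UP_mult_closed)
  then have "?a \<odot>\<^bsub>UP R\<^esub> (g \<otimes>\<^bsub>UP R\<^esub> h) = \<zero>\<^bsub>UP R\<^esub>"
    using fgh a by (intro U.up_eqI) (auto simp del: U.coeff_mult)
  then have "(?a \<odot>\<^bsub>UP R\<^esub> g) \<otimes>\<^bsub>UP R\<^esub> h = \<zero>\<^bsub>UP R\<^esub>"
    using fgh a by (simp add: U.UP_smult_assoc2)
  then have "coeff (UP R) (?a \<odot>\<^bsub>UP R\<^esub> g) j \<otimes> coeff (UP R) h k = \<zero>"
    using A fgh a unfolding Armendariz_def by (meson U.UP_smult_closed)
  then show ?thesis
    using fgh a by simp
qed

lemma P_symmetric_imp_UP:
  assumes A: "Armendariz R" and R: "P_symmetric R"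
  shows "P_symmetric (UP R)"
  unfolding P_symmetric_def
proof (intro ballI impI)
  interpret U: UP_ring R "UP R"
    by (simp add: UP_ring_def ring_axioms)
  fix f g h
  assume fgh: "f \<in> carrier (UP R)" "g \<in> carrier (UP R)" "h \<in> carrier (UP R)"
    and 0: "f \<otimes>\<^bsub>UP R\<^esub> g \<otimes>\<^bsub>UP R\<^esub> h = \<zero>\<^bsub>UP R\<^esub>"
  have "g \<otimes>\<^bsub>UP R\<^esub> f \<otimes>\<^bsub>UP R\<^esub> h \<in> Q" if Q: "prime_two_sided_ideal Q (UP R)" for Q
  proof (rule UP_mem_ideal)
    show "ideal Q (UP R)"
      using Q by (rule prime_two_sided_ideal_imp_ideal)
    \<comment> \<open>Coefficients live in \<open>R\<close>, so \<open>Q\<close> is replaced by its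
      prime contraction, which contains \<open>prime_radical R\<close>.\<close>
    define P where "P = {a \<in> carrier R. monom (UP R) a 0 \<in> Q}"
    have P: "prime_two_sided_ideal P R"
      unfolding P_def using Q by (rule prime_two_sided_ideal_constants)
    interpret P: ideal P R
      using P by (rule prime_two_sided_ideal_imp_ideal)
    have mem: "coeff (UP R) g j \<otimes> coeff (UP R) f i \<otimes> coeff (UP R) h k \<in> P" for i j k
    proof -
      have "coeff (UP R) g j \<otimes> coeff (UP R) f i \<otimes> coeff (UP R) h k \<in> prime_radical R"
        using R Armendariz_triple[OF A fgh 0] fgh unfolding P_symmetric_def by simp
      with P show ?thesis
        by (auto simp: prime_radical_def)
    qed
    \<comment> \<open>The coefficient of \<open>g f h\<close> at \<open>n\<close>, written out so
      that after distributing each summand is a product covered by \<open>mem\<close>.\<close>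
    have "(\<Oplus>k\<in>{..n}. (\<Oplus>j\<in>{..k}. coeff (UP R) g j \<otimes> coeff (UP R) f (k - j)) \<otimes> coeff (UP R) h (n - k)) \<in> P" for n
    proof (rule P.finsum_mem)
      fix k
      have "(\<Oplus>j\<in>{..k}. coeff (UP R) g j \<otimes> coeff (UP R) f (k - j)) \<otimes> coeff (UP R) h (n - k)
        = (\<Oplus>j\<in>{..k}. coeff (UP R) g j \<otimes> coeff (UP R) f (k - j) \<otimes> coeff (UP R) h (n - k))"
        using fgh by (intro finsum_ldistr) auto
      also have "\<dots> \<in> P"
        by (rule P.finsum_mem) (rule mem)
      finally show "(\<Oplus>j\<in>{..k}. coeff (UP R) g j \<otimes> coeff (UP R) f (k - j)) \<otimes> coeff (UP R) h (n - k) \<in> P" .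
    qed
    then have "coeff (UP R) (g \<otimes>\<^bsub>UP R\<^esub> f \<otimes>\<^bsub>UP R\<^esub> h) n \<in> P" for n
      using fgh by simp
    then show "monom (UP R) (coeff (UP R) (g \<otimes>\<^bsub>UP R\<^esub> f \<otimes>\<^bsub>UP R\<^esub> h) n) 0 \<in> Q" for n
      unfolding P_def by blast
  qed (use fgh in simp)
  then show "g \<otimes>\<^bsub>UP R\<^esub> f \<otimes>\<^bsub>UP R\<^esub> h \<in> prime_radical (UP R)"
    using fgh by (simp add: prime_radical_def)
qed

end

theorem theorem2p18:
  fixes R :: "('a, 'm) ring_scheme"
  assumes "ring R"
  shows "(P_symmetric (UP R) \<longrightarrow> P_symmetric (Laurent R)) \<and>
         (P_symmetric (Laurent R) \<longrightarrow> P_symmetric R) \<and>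
         (Armendariz R \<longrightarrow> P_symmetric R \<longrightarrow> P_symmetric (UP R))"
  using ring.P_symmetric_UP_imp_Laurent[OF assms] ring.P_symmetric_Laurent_imp_base[OF assms]
    ring.P_symmetric_imp_UP[OF assms]
  by blast

end
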